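(* Let $k$ be any field of characteristic different from $2$, let $C\in\operatorname{Mat}_2(k)$ be cyclic, and put $\tau=\operatorname{tr}(C)$, $\nu=\det(C)$. (a) If $\tau=0$ (either with $\nu\neq0$ or with $\nu=0$), there exists a two-point translated sample $G_1\neq G_2$ in $\operatorname{Mat}_2(k)$ that is compatible with two inequivalent common left multipliers $F,F'\in\operatorname{GL}_2(k)$. (b) If $\tau\ne0$, there exists a three-point translated sample of pairwise distinct matrices $G_1,G_2,G_3$ in $\operatorname{Mat}_2(k)$ that is compatible with two distinct common left multipliers $F\neq F'$ in $\operatorname{GL}_2(k)$. In this sense, no uniform rigidity theorem (determination of the common left multiplier up to $\Gamma_C(k)$) can hold with fewer than three samples when $\tau=0$, or with fewer than four samples when $\tau\neq0$.
   Context: A matrix $C\in\operatorname{Mat}_2(k)$ is cyclic if there exists $v\in k^2$ such that $(v,Cv)$ is a basis of $k^2$. $\operatorname{Orb}(C)=\{PCP^{-1}:P\in\operatorname{GL}_2(k)\}$. A translated sample $G_1,\dots,G_m$ is compatible with a common left multiplier $F\in\operatorname{GL}_2(k)$ if $F^{-1}G_i\in\operatorname{Orb}(C)$ for all $i$, i.e. $G_i=FK_i$ with $K_i\in\operatorname{Orb}(C)$. The left stabilizer is $\Gamma_C(k)=\{H\in\operatorname{GL}_2(k):H\operatorname{Orb}(C)=\operatorname{Orb}(C)\}$; it equals $\{I_2\}$ if $\tau\ne0$, $\{\pm I_2\}$ if $\tau=0,\nu\neq0$, and $k^\times I_2$ if $\tau=\nu=0$. Two multipliers $F,F'$ are inequivalent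 if $F\,\Gamma_C(k)\neq F'\,\Gamma_C(k)$. *)

theory Defs
  imports "HOL-Analysis.Analysis"
begin

definition cyclic_matrix :: "'a::field^2^2 \<Rightarrow> bool" where
  "cyclic_matrix C \<longleftrightarrow>
     (\<exists>v::'a^2. v \<noteq> C *v v \<and> vec.independent {v, C *v v} \<and> vec.span {v, C *v v} = UNIV)"

definition Orb :: "'a::field^2^2 \<Rightarrow> ('a^2^2) set" where
  "Orb C = {P ** C ** matrix_inv P |P. invertible P}"

definition left_stabilizer :: "'a::field^2^2 \<Rightarrow> ('a^2^2) set" where
  "left_stabilizer C = {H. invertible H \<and> (\<lambda>K. H ** K) ` Orb C = Orb C}"

text \<open>
  A sample \<open>G\<^sub>1, \<dots>, G\<^sub>m\<close> is a list, so it is ordered and may contain repetitions;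
  distinctness is always stated separately.
\<close>

definition compatible :: "'a::field^2^2 \<Rightarrow> ('a^2^2) list \<Rightarrow> 'a^2^2 \<Rightarrow> bool" where
  "compatible C Gs F \<longleftrightarrow> invertible F \<and> (\<forall>G\<in>set Gs. matrix_inv F ** G \<in> Orb C)"

definition inequivalent_multipliers :: "'a::field^2^2 \<Rightarrow> 'a^2^2 \<Rightarrow> 'a^2^2 \<Rightarrow> bool" where
  "inequivalent_multipliers C F F' \<longleftrightarrow>
     (\<lambda>H. F ** H) ` left_stabilizer C \<noteq> (\<lambda>H. F' ** H) ` left_stabilizer C"

text \<open>
  Uniform rigidity with \<open>m\<close> samples: every sample of \<open>m\<close> pairwise distinct matrices determines
  its common left multiplier up to the left stabilizer. Only distinct samples are
  considered; otherwise repeating a matrix would make failure for \<open>m\<close> samples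
  a trivial consequence of failure for fewer.
\<close>

definition uniform_rigidity :: "'a::field^2^2 \<Rightarrow> nat \<Rightarrow> bool" where
  "uniform_rigidity C m \<longleftrightarrow>
     (\<forall>Gs F F'. length Gs = m \<longrightarrow> distinct Gs \<longrightarrow> compatible C Gs F \<longrightarrow> compatible C Gs F' \<longrightarrow>
        \<not> inequivalent_multipliers C F F')"

end

theory Submission
  imports Defs
begin

text \<open>
  For cyclic \<open>C\<close>, every matrix with the trace and determinant of \<open>C\<close> and a nonzero lower left entry
  lies in \<open>Orb C\<close>, because both it and \<open>C\<close> are similar to the companion matrix of their common
  characteristic polynomial (\<open>mat2_in_Orb\<close>). Membership in the orbit thus reduces to two equations:
  a quadratic one for the determinant, and a linear one for the trace.

  Let \<open>A\<close> be invertible, and suppose that \<open>K\<close> and \<open>A K\<close> lie in \<open>Orb C\<close> for all \<open>K\<close> in some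
  finite list. Then the matrices \<open>A K\<close> form a sample that is compatible with both multipliers \<open>A\<close>
  and \<open>I\<close>, and these are inequivalent as soon as \<open>A\<close> moves some element of \<open>Orb C\<close> out of
  \<open>Orb C\<close> (\<open>compatible_translates\<close>). So it suffices to find such an \<open>A\<close> of determinant one for
  which the linear condition that \<open>A K\<close> and \<open>C\<close> have the same trace has many solutions \<open>K\<close> in the
  orbit without holding on all of it. Write \<open>\<tau>\<close> and \<open>\<nu>\<close> for the trace and the determinant of \<open>C\<close>.

  If \<open>\<tau> = 0\<close>, the trace condition is homogeneous and the orbit is closed under negation, so a single
  solution \<open>K\<close> gives the second solution \<open>- K\<close>. The matrix \<open>A\<close> with rows \<open>(1 + \<nu>, \<nu>)\<close> and \<open>(1, 1)\<close>
  is chosen so that the companion matrix is such a \<open>K\<close>.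

  If \<open>\<tau> \<noteq> 0\<close>, the matrix \<open>A\<close> with rows \<open>(-1, 2\<tau>)\<close> and \<open>(0, -1)\<close> changes the trace of \<open>K\<close> from
  \<open>\<tau>\<close> to \<open>2\<tau>z - \<tau>\<close>, where \<open>z\<close> is the lower left entry of \<open>K\<close>. The condition is \<open>z = 1\<close>, and it
  leaves the upper left entry free. This gives a one-parameter family of solutions, and the parameter
  takes at least the three values \<open>0\<close>, \<open>1\<close>, \<open>-1\<close>, even over the field with three elements.
\<close>

section \<open>Two by two matrices\<close>

definition mat2 :: "'a::field \<Rightarrow> 'a \<Rightarrow> 'a \<Rightarrow> 'a \<Rightarrow> 'a^2^2" where
  "mat2 a b c d = vector [vector [a, b], vector [c, d]]"

lemma mat2_nth [simp]:
  "mat2 a b c d $ 1 $ 1 = a" "mat2 a b c d $ 1 $ 2 = b"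
  "mat2 a b c d $ 2 $ 1 = c" "mat2 a b c d $ 2 $ 2 = d"
  by (simp_all add: mat2_def)

lemma mat2_eq_iff [simp]:
  "mat2 a b c d = mat2 a' b' c' d' \<longleftrightarrow> a = a' \<and> b = b' \<and> c = c' \<and> d = d'"
  by (auto simp: vec_eq_iff forall_2)

lemma mat2_collapse: "mat2 (M $ 1 $ 1) (M $ 1 $ 2) (M $ 2 $ 1) (M $ 2 $ 2) = M"
  by (simp add: vec_eq_iff forall_2)

lemma mat2_mult:
  "mat2 a b c d ** mat2 a' b' c' d' =
     mat2 (a * a' + b * c') (a * b' + b * d') (c * a' + d * c') (c * b' + d * d')"
  by (simp add: vec_eq_iff forall_2 matrix_matrix_mult_def sum_2)

lemma trace_mat2 [simp]: "trace (mat2 a b c d) = a + d"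
  by (simp add: trace_def sum_2)

lemma det_mat2 [simp]: "det (mat2 a b c d) = a * d - b * c"
  by (simp add: det_2)

lemma two_neq_zero:
  assumes "CHAR('a::field) \<noteq> 2"
  shows "(2::'a) \<noteq> 0"
proof
  assume "(2::'a) = 0"
  then have "of_nat 2 = (0::'a)" by simp
  then have dvd: "CHAR('a) dvd 2" by (simp only: of_nat_eq_0_iff_char_dvd)
  then have "CHAR('a) \<le> 2" by (rule dvd_imp_le) simp
  moreover have "CHAR('a) \<noteq> 0" using dvd by (metis dvd_0_left_iff zero_neq_numeral)
  moreover have "CHAR('a) \<noteq> 1" by simp
  ultimately show False using assms by linarith
qed

section \<open>The orbit of a cyclic matrix\<close>

lemma matrix_inv_mult:
  assumes "invertible (A :: 'a::field^2^2)"
  shows "A ** matrix_inv A = mat 1" "matrix_inv A ** A = mat 1"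
  using someI_ex[OF assms[unfolded invertible_def]] by (auto simp: matrix_inv_def)

lemma matrix_inv_cancel:
  assumes "invertible (A :: 'a::field^2^2)"
  shows "matrix_inv A ** (A ** K) = K"
  using assms by (simp add: matrix_mul_assoc matrix_inv_mult)

lemma matrix_inv_mat_1 [simp]: "matrix_inv (mat 1 :: 'a::field^2^2) = mat 1"
proof -
  have "invertible (mat 1 :: 'a^2^2)" by (auto simp: invertible_def)
  from matrix_inv_mult(1)[OF this] show ?thesis by simp
qed

lemma OrbI:
  assumes "invertible S" "M ** S = S ** C"
  shows "M \<in> Orb (C :: 'a::field^2^2)"
proof -
  have "M = M ** (S ** matrix_inv S)"
    by (simp add: matrix_inv_mult[OF assms(1)])
  also have "\<dots> = S ** C ** matrix_inv S"
    by (simp add: matrix_mul_assoc assms(2))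
  finally show ?thesis
    using assms(1) by (auto simp: Orb_def)
qed

lemma trace_Orb:
  assumes "M \<in> Orb (C :: 'a::field^2^2)"
  shows "trace M = trace C"
proof -
  from assms obtain P where P: "invertible P" "M = P ** C ** matrix_inv P"
    by (auto simp: Orb_def)
  have "trace M = trace (matrix_inv P ** (P ** C))"
    unfolding P(2) by (rule trace_mul_sym)
  with P(1) show ?thesis by (simp add: matrix_inv_cancel)
qed

text \<open>
  In the basis \<open>(v, C v)\<close> the matrix \<open>C\<close> sends the first vector to the second, and by
  Cayley-Hamilton the second to \<open>\<tau> C v - \<nu> v\<close>.
\<close>

lemma cyclic_matrix_similar_companion:
  fixes C :: "'a::field^2^2"
  assumes "cyclic_matrix C"
  obtains Q where "invertible Q" "C ** Q = Q ** mat2 0 (- det C) 1 (trace C)"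
proof -
  obtain v where v: "vec.span {v, C *v v} = UNIV"
    using assms by (auto simp: cyclic_matrix_def)
  define w where "w = C *v v"
  define Q where "Q = mat2 (v $ 1) (w $ 1) (v $ 2) (w $ 2)"
  have "column 1 Q = v" "column 2 Q = w"
    by (simp_all add: Q_def column_def vec_eq_iff forall_2)
  then have "columns Q = {v, w}"
    by (auto simp: columns_def UNIV_2)
  then have "\<exists>B. Q ** B = mat 1"
    using v matrix_right_invertible_span_columns[of Q] by (simp add: w_def)
  then have "invertible Q"
    by (simp add: invertible_right_inverse)
  moreover have "C ** Q = Q ** mat2 0 (- det C) 1 (trace C)"
  proof -
    obtain p q r s where C: "C = mat2 p q r s"
      using mat2_collapse[of C] by metis
    show ?thesis
      unfolding Q_def w_def C
      by (simp add: mat2_mult matrix_vector_mult_def sum_2 algebra_simps)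
  qed
  ultimately show thesis by (rule that)
qed

text \<open>
  When \<open>z \<noteq> 0\<close>, the first standard basis vector is a cyclic vector of the matrix on the left, which is
  therefore similar to the same companion matrix as \<open>C\<close>.
\<close>

lemma mat2_in_Orb:
  fixes C :: "'a::field^2^2"
  assumes "cyclic_matrix C" "z \<noteq> 0" "x + t = trace C" "x * t - y * z = det C"
  shows "mat2 x y z t \<in> Orb C"
proof -
  define B where "B = mat2 0 (- det C) 1 (trace C)"
  obtain Q where Q: "invertible Q" "C ** Q = Q ** B"
    using cyclic_matrix_similar_companion[OF assms(1)] unfolding B_def by blast
  define R where "R = mat2 1 x 0 z"
  have R: "invertible R"
    using assms(2) by (simp add: invertible_det_nz R_def)
  have MR: "mat2 x y z t ** R = R ** B"
    unfolding R_def B_def assms(3,4)[symmetric] by (simp add: mat2_mult algebra_simps)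
  have QB: "matrix_inv Q ** C = B ** matrix_inv Q"
  proof -
    have "matrix_inv Q ** C = matrix_inv Q ** (C ** Q) ** matrix_inv Q"
      by (simp add: matrix_inv_mult[OF Q(1)] flip: matrix_mul_assoc)
    also have "\<dots> = B ** matrix_inv Q"
      by (simp add: Q(2) matrix_inv_cancel[OF Q(1)])
    finally show ?thesis .
  qed
  have "invertible (matrix_inv Q)"
    using matrix_inv_mult[OF Q(1)] by (auto simp: invertible_def)
  then have "invertible (R ** matrix_inv Q)"
    using R by (rule invertible_mult[rotated])
  moreover have "mat2 x y z t ** (R ** matrix_inv Q) = R ** matrix_inv Q ** C"
    by (simp add: matrix_mul_assoc MR) (simp add: QB flip: matrix_mul_assoc)
  ultimately show ?thesis by (rule OrbI)
qed

section \<open>Samples with two common left multipliers\<close>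

lemma mat_1_in_left_stabilizer: "mat 1 \<in> left_stabilizer (C :: 'a::field^2^2)"
  by (auto simp: left_stabilizer_def invertible_def)

lemma compatible_translates:
  fixes C :: "'a::field^2^2"
  assumes A: "invertible A"
    and Ks: "distinct Ks" "set Ks \<subseteq> Orb C" "(\<lambda>K. A ** K) ` set Ks \<subseteq> Orb C"
    and K: "K \<in> Orb C" "A ** K \<notin> Orb C"
  defines "Gs \<equiv> map (\<lambda>K. A ** K) Ks"
  shows "distinct Gs" "compatible C Gs A" "compatible C Gs (mat 1)"
    "inequivalent_multipliers C A (mat 1)"
proof -
  have "inj_on (\<lambda>K. A ** K) (set Ks)"
    by (rule inj_on_inverseI[of _ "\<lambda>K. matrix_inv A ** K"]) (rule matrix_inv_cancel[OF A])
  then show "distinct Gs" using Ks(1) by (simp add: Gs_def distinct_map)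
  show "compatible C Gs A"
    using A Ks(2) by (auto simp: compatible_def Gs_def matrix_inv_cancel)
  show "compatible C Gs (mat 1)"
    using Ks(3) by (auto simp: compatible_def Gs_def invertible_def)
  show "inequivalent_multipliers C A (mat 1)"
    unfolding inequivalent_multipliers_def
  proof
    \<comment> \<open>As the stabilizer contains \<open>I\<close>, equality of the two cosets would put \<open>A\<close> into it.\<close>
    assume "(\<lambda>H. A ** H) ` left_stabilizer C = (\<lambda>H. mat 1 ** H) ` left_stabilizer C"
    then have "A ** mat 1 \<in> left_stabilizer C"
      using imageI[OF mat_1_in_left_stabilizer[of C], of "\<lambda>H. A ** H"] by simp
    then have "(\<lambda>K. A ** K) ` Orb C = Orb C"
      by (simp add: left_stabilizer_def)
    with K show False by blast
  qed
qed

text \<open>A sample that refutes rigidity also does so for every smaller size, by truncation.\<close>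

lemma not_uniform_rigidity:
  assumes "distinct Gs" "compatible C Gs F" "compatible C Gs F'"
    "inequivalent_multipliers C F F'" "m \<le> length Gs"
  shows "\<not> uniform_rigidity C m"
proof -
  have "compatible C (take m Gs) F" "compatible C (take m Gs) F'"
    using assms(2,3) by (auto simp: compatible_def dest: in_set_takeD)
  moreover have "length (take m Gs) = m" "distinct (take m Gs)"
    using assms(1,5) by auto
  ultimately show ?thesis
    using assms(4) unfolding uniform_rigidity_def by blast
qed

lemma trace_zero_two_samples:
  fixes C :: "'a::field^2^2"
  assumes two: "(2::'a) \<noteq> 0" and C: "cyclic_matrix C" and tr: "trace C = 0"
  obtains G1 G2 F F' where "distinct [G1, G2]" "compatible C [G1, G2] F" "compatible C [G1, G2] F'"
    "inequivalent_multipliers C F F'"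
proof -
  define n where "n = det C"
  \<comment> \<open>For trace-free \<open>K\<close> with rows \<open>(x, y)\<close> and \<open>(z, -x)\<close>, the product \<open>A K\<close> has trace
      \<open>n x + n z + y\<close>, which vanishes on the companion matrix \<open>(x, y, z) = (0, -n, 1)\<close>.\<close>
  define A where "A = mat2 (1 + n) n 1 1"
  define K1 where "K1 = mat2 0 (- n) 1 0"
  define K2 where "K2 = mat2 0 n (- 1) 0"
  note orb = mat2_in_Orb[OF C, unfolded tr, folded n_def]
  have A: "invertible A" by (simp add: A_def invertible_det_nz)
  have neq: "(1::'a) \<noteq> - 1" using two by (metis add.right_inverse one_add_one)
  have "distinct [K1, K2]" using neq by (simp add: K1_def K2_def)
  moreover have "set [K1, K2] \<subseteq> Orb C" by (auto simp: K1_def K2_def intro!: orb)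
  moreover have "(\<lambda>K. A ** K) ` set [K1, K2] \<subseteq> Orb C"
    by (auto simp: A_def K1_def K2_def mat2_mult algebra_simps intro!: orb)
  moreover obtain K where "K \<in> Orb C" "A ** K \<notin> Orb C"
  proof -
    \<comment> \<open>The traces of \<open>A L1\<close> and \<open>A L2\<close> are \<open>n + 1\<close> and \<open>n - 1\<close>, which differ by \<open>2 \<noteq> 0\<close>.\<close>
    define L1 where "L1 = mat2 1 (1 + n) (- 1) (- 1)"
    define L2 where "L2 = mat2 1 (- 1 - n) 1 (- 1)"
    have "L1 \<in> Orb C" "L2 \<in> Orb C"
      by (auto simp: L1_def L2_def algebra_simps intro!: orb)
    moreover have "trace (A ** L1) = n + 1" "trace (A ** L2) = n - 1"
      by (simp_all add: A_def L1_def L2_def mat2_mult algebra_simps)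
    moreover have "\<not> (n + 1 = 0 \<and> n - 1 = 0)" using neq by (metis add_eq_0_iff2 right_minus_eq)
    ultimately show thesis using that trace_Orb[of _ C] tr by metis
  qed
  ultimately have "distinct [A ** K1, A ** K2]" "compatible C [A ** K1, A ** K2] A"
      "compatible C [A ** K1, A ** K2] (mat 1)" "inequivalent_multipliers C A (mat 1)"
    using compatible_translates[OF A, of "[K1, K2]" C K] by auto
  then show thesis by (rule that)
qed

lemma trace_nonzero_three_samples:
  fixes C :: "'a::field^2^2"
  assumes two: "(2::'a) \<noteq> 0" and C: "cyclic_matrix C" and tr: "trace C \<noteq> 0"
  obtains G1 G2 G3 F F' where "distinct [G1, G2, G3]" "compatible C [G1, G2, G3] F"
    "compatible C [G1, G2, G3] F'" "inequivalent_multipliers C F F'"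
proof -
  define n where "n = det C"
  define t where "t = trace C"
  define A where "A = mat2 (- 1) (2 * t) 0 (- 1)"
  define K where "K x = mat2 x (x * (t - x) - n) 1 (t - x)" for x
  note orb = mat2_in_Orb[OF C, folded n_def t_def]
  have A: "invertible A" by (simp add: A_def invertible_det_nz)
  have neq: "(1::'a) \<noteq> - 1" using two by (metis add.right_inverse one_add_one)
  have "distinct [K 0, K 1, K (- 1)]" using neq by (simp add: K_def)
  moreover have "K x \<in> Orb C" for x
    unfolding K_def by (rule orb) (simp_all add: algebra_simps)
  then have "set [K 0, K 1, K (- 1)] \<subseteq> Orb C" by simp
  moreover have "A ** K x \<in> Orb C" for x
    unfolding A_def K_def mat2_mult by (rule orb) (simp_all add: algebra_simps)
  then have "(\<lambda>K. A ** K) ` set [K 0, K 1, K (- 1)] \<subseteq> Orb C" by simp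
  moreover have "mat2 0 n (- 1) t \<in> Orb C" by (rule orb) simp_all
  moreover have "A ** mat2 0 n (- 1) t \<notin> Orb C"
  proof
    \<comment> \<open>Here the lower left entry is \<open>-1\<close>, and the product has trace \<open>-3t\<close> instead of \<open>t\<close>.\<close>
    assume "A ** mat2 0 n (- 1) t \<in> Orb C"
    then have "trace (A ** mat2 0 n (- 1) t) = t" unfolding t_def by (rule trace_Orb)
    then have "2 * (2 * t) = 0" by (simp add: A_def mat2_mult algebra_simps)
    then show False using two tr unfolding t_def by (metis mult_eq_0_iff)
  qed
  ultimately have "distinct [A ** K 0, A ** K 1, A ** K (- 1)]"
      "compatible C [A ** K 0, A ** K 1, A ** K (- 1)] A"
      "compatible C [A ** K 0, A ** K 1, A ** K (- 1)] (mat 1)"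
      "inequivalent_multipliers C A (mat 1)"
    using compatible_translates[OF A, of "[K 0, K 1, K (- 1)]" C "mat2 0 n (- 1) t"] by auto
  then show thesis by (rule that)
qed

theorem theorem6p3:
  fixes C :: "'a::field^2^2"
  assumes "CHAR('a) \<noteq> 2"
    and "cyclic_matrix C"
  shows "(trace C = 0 \<longrightarrow>
            (\<exists>G1 G2 F F'. G1 \<noteq> G2 \<and> compatible C [G1, G2] F \<and> compatible C [G1, G2] F' \<and>
               inequivalent_multipliers C F F'))
       \<and> (trace C \<noteq> 0 \<longrightarrow>
            (\<exists>G1 G2 G3 F F'. G1 \<noteq> G2 \<and> G1 \<noteq> G3 \<and> G2 \<noteq> G3 \<and>
               compatible C [G1, G2, G3] F \<and> compatible C [G1, G2, G3] F' \<and> F \<noteq> F'))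
       \<and> (trace C = 0 \<longrightarrow> (\<forall>m<3. \<not> uniform_rigidity C m))
       \<and> (trace C \<noteq> 0 \<longrightarrow> (\<forall>m<4. \<not> uniform_rigidity C m))"
proof (cases "trace C = 0")
  case True
  obtain G1 G2 F F' where G: "distinct [G1, G2]" "compatible C [G1, G2] F"
      "compatible C [G1, G2] F'" "inequivalent_multipliers C F F'"
    using trace_zero_two_samples[OF two_neq_zero[OF assms(1)] assms(2) True] .
  have "\<forall>m<3. \<not> uniform_rigidity C m"
    using not_uniform_rigidity[OF G] by simp
  moreover have "G1 \<noteq> G2" using G(1) by simp
  ultimately show ?thesis using True G(2-4) by blast
next
  case False
  obtain G1 G2 G3 F F' where G: "distinct [G1, G2, G3]" "compatible C [G1, G2, G3] F"
      "compatible C [G1, G2, G3] F'" "inequivalent_multipliers C F F'"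
    using trace_nonzero_three_samples[OF two_neq_zero[OF assms(1)] assms(2) False] .
  have "\<forall>m<4. \<not> uniform_rigidity C m"
    using not_uniform_rigidity[OF G] by simp
  moreover have "G1 \<noteq> G2" "G1 \<noteq> G3" "G2 \<noteq> G3" using G(1) by simp_all
  moreover have "F \<noteq> F'" using G(4) by (auto simp: inequivalent_multipliers_def)
  ultimately show ?thesis using False G(2,3) by blast
qed

end
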